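(* Let $L$ be a finite lattice with minimum $\hat{0}$ and maximum $\hat{1}$, generalized graded by $\rho$, and let $x \in L$ be a left-modular element. For $b \in L$ with $b \wedge x = \hat{0}$ let $\tau_b : [\hat{0}, x] \to [b, x \vee b]$ be given by $\tau_b(v) = v \vee b$. Suppose that for every $b \in H(L)$ with $b \wedge x = \hat{0}$, the map $\tau_b$ is rank-preserving on $H(\hat{0},x) \cup \{x\}$. Then $$\chi(L,t) = \chi([\hat{0},x],t) \sum_{b \in H(L):\ b \wedge x = \hat{0}} \mu(b)\, t^{\rho(\hat{1}) - \rho(x) - \rho(b)}.$$
   Context: A generalized rank function on $L$ is a function $\rho : \{(u,v) \in L\times L : u \le v\} \to \mathbb{R}$ with $\rho(a,c) = \rho(a,b) + \rho(b,c)$ for all $a \le b \le c$; $L$ is then generalized graded by $\rho$, and $\rho(u) = \rho(\hat{0},u)$. The characteristic polynomial is $\chi(L,t) = \sum_{u \in L} \mu(u)\, t^{\rho(u,\hat{1})}$, where $\mu(u) = \mu(\hat{0},u)$ is the Möbius function; for an interval $[a,c]$, $\chi([a,c],t) = \sum_{u\in[a,c]} \mu(a,u) t^{\rho(u,c)}$. $H(L) = \{u \in L : \mu(\hat{0},u) \neq 0\}$ and $H(\hat{0},x)$ is the analogous set for the interval $[\hat{0},x]$. A map $\tau$ between generalized graded lattices (the interval $[b,x\vee b]$ carrying the restriction of $\rho$) is rank-preserving on a subset $S$ if $\rho(u,v) = \rho(\tau(u),\tau(v))$ for all $u \le v$ in $S$. An element $x$ is left-modular if for all $y,z\in L$ with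 $z<y$ one has $z\vee(x\wedge y) = (z\vee x)\wedge y$. *)

theory Defs
  imports Complex_Main "HOL-Library.Poly_Mapping"
begin

unbundle lattice_syntax

function mobius :: "'a::{finite, order} \<Rightarrow> 'a \<Rightarrow> int" where
  "mobius a b =
     (if a = b then 1 else if a < b then - (\<Sum>u\<in>{a..<b}. mobius a u) else 0)"
  by pat_completeness auto
termination
proof (relation "measure (\<lambda>(a, b). card {a..<b})", goal_cases)
  case 1
  show ?case by simp
next
  case (2 a b u)
  then have "{a..<u} \<subset> {a..<b}" by (auto dest: less_trans)
  then show ?case by (simp add: psubset_card_mono)
qed

declare mobius.simps [simp del]

(* A rank function lives on the pairs u \<le> v only; it is encoded as a total binary
   function whose values on other pairs are unconstrained and never used. *)
definition generalized_rank :: "('a::order \<Rightarrow> 'a \<Rightarrow> real) \<Rightarrow> bool" where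
  "generalized_rank \<rho> \<longleftrightarrow>
     (\<forall>a b c. a \<le> b \<longrightarrow> b \<le> c \<longrightarrow> \<rho> a c = \<rho> a b + \<rho> b c)"

(* Generalized polynomials in t with integer coefficients and real exponents:
   formal finite sums, i.e. the group ring of (real, +) over int.  The monomial
   c * t^r is Poly_Mapping.single r c. *)
type_synonym gen_poly = "real \<Rightarrow>\<^sub>0 int"

(* The characteristic polynomial of the interval [a, c]; that of the whole lattice
   is the case a = \<bottom>, c = \<top>. *)
definition char_poly ::
  "('a::{finite, order} \<Rightarrow> 'a \<Rightarrow> real) \<Rightarrow> 'a \<Rightarrow> 'a \<Rightarrow> gen_poly" where
  "char_poly \<rho> a c = (\<Sum>u\<in>{a..c}. Poly_Mapping.single (\<rho> u c) (mobius a u))"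

(* H(a, c); the set H(L) is the case a = \<bottom>, c = \<top>. *)
definition mobius_support :: "'a::{finite, order} \<Rightarrow> 'a \<Rightarrow> 'a set" where
  "mobius_support a c = {u \<in> {a..c}. mobius a u \<noteq> 0}"

definition rank_preserving_on ::
  "('a::order \<Rightarrow> 'a \<Rightarrow> real) \<Rightarrow> ('b::order \<Rightarrow> 'b \<Rightarrow> real) \<Rightarrow> ('a \<Rightarrow> 'b) \<Rightarrow> 'a set \<Rightarrow> bool" where
  "rank_preserving_on \<rho> \<rho>' \<tau> S \<longleftrightarrow>
     (\<forall>u\<in>S. \<forall>v\<in>S. u \<le> v \<longrightarrow> \<rho> u v = \<rho>' (\<tau> u) (\<tau> v))"

definition left_modular :: "'a::lattice \<Rightarrow> bool" where
  "left_modular x \<longleftrightarrow> (\<forall>y z. z < y \<longrightarrow> z \<squnion> (x \<sqinter> y) = (z \<squnion> x) \<sqinter> y)"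

end

theory Submission
  imports Defs
begin

text \<open>
  The engine is the identity
  \<open>\<mu>(y) = (\<Sum>(v, b). \<mu>(v) \<mu>(b))\<close>, the sum being over all \<open>v \<le> x\<close> and \<open>b\<close> with \<open>b \<sqinter> x = \<bottom>\<close>
  and \<open>v \<squnion> b = y\<close>. By Moebius inversion it suffices to sum both sides over \<open>y \<le> w\<close>. The right-hand
  side then becomes a product of a sum over \<open>v \<le> x \<sqinter> w\<close>, which vanishes unless \<open>x \<sqinter> w = \<bottom>\<close>, and
  a sum over \<open>b \<le> w\<close>, in which the condition on \<open>b\<close> is void as soon as \<open>x \<sqinter> w = \<bottom>\<close>. Substituting the
  identity into \<open>\<chi>(L, t)\<close>, the rank hypothesis splits \<open>\<rho>(v \<squnion> b, \<top>)\<close> as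
  \<open>\<rho>(v, x) + (\<rho>(\<top>) - \<rho>(x) - \<rho>(b))\<close>.
\<close>

lemma mobius_refl [simp]: "mobius a a = 1"
  by (simp add: mobius.simps)

lemma sum_mobius_atMost:
  fixes w :: "'a::{finite, bounded_lattice}"
  shows "(\<Sum>u | u \<le> w. mobius \<bottom> u) = (if w = \<bottom> then 1 else 0)"
proof (cases "w = \<bottom>")
  case True
  then have "{u. u \<le> w} = {\<bottom>}" by (auto simp: bot_unique)
  with True show ?thesis by simp
next
  case False
  have "{u. u \<le> w} = insert w {\<bottom>..<w}" by auto
  moreover have "mobius \<bottom> w = - (\<Sum>u\<in>{\<bottom>..<w}. mobius \<bottom> u)"
    using False mobius.simps[of \<bottom> w] by (simp add: bot.not_eq_extremum)
  ultimately show ?thesis using False by simp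
qed

text \<open>Moebius inversion in the form of uniqueness, by induction on the number of elements
  strictly below \<open>w\<close>: once \<open>f\<close> and \<open>g\<close> agree there, the two
  sums up to \<open>w\<close> can differ only in the term at \<open>w\<close>.\<close>

lemma eq_if_sum_atMost_eq:
  fixes f g :: "'a::{finite, order} \<Rightarrow> 'b::ab_group_add"
  assumes "\<And>w. (\<Sum>y | y \<le> w. f y) = (\<Sum>y | y \<le> w. g y)"
  shows "f w = g w"
proof (induction "card {y. y < w}" arbitrary: w rule: less_induct)
  case less
  have "f y = g y" if "y < w" for y
    using that by (intro less psubset_card_mono) (auto dest: less_trans)
  then have "(\<Sum>y | y < w. f y) = (\<Sum>y | y < w. g y)" by simp
  moreover have "{y. y \<le> w} = insert w {y. y < w}" by auto
  ultimately show ?case using assms[of w] by simp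
qed

lemma mobius_eq_sum_join:
  fixes x y :: "'a::{finite, bounded_lattice}"
  shows "mobius \<bottom> y =
    (\<Sum>(v, b) | (v, b) \<in> {..x} \<times> {b. b \<sqinter> x = \<bottom>} \<and> v \<squnion> b = y. mobius \<bottom> v * mobius \<bottom> b)"
    (is "_ = ?f y")
proof (rule eq_if_sum_atMost_eq[of "mobius \<bottom>" ?f])
  fix w :: 'a
  \<comment> \<open>A pair with join \<open>y \<le> w\<close> has both components below
    \<open>w\<close>, so these bounds may be added. The index set thus becomes a product independent
    of \<open>y\<close>, which the fibres of the join over \<open>y \<le> w\<close>
    partition.\<close>
  have "(\<Sum>y | y \<le> w. ?f y) =
    (\<Sum>y | y \<le> w. \<Sum>p | p \<in> {v. v \<le> x \<sqinter> w} \<times> {b. b \<sqinter> x = \<bottom> \<and> b \<le> w} \<and> fst p \<squnion> snd p = y.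
      mobius \<bottom> (fst p) * mobius \<bottom> (snd p))"
    by (intro sum.cong refl) (auto simp: case_prod_unfold)
  also have "\<dots> = (\<Sum>p \<in> {v. v \<le> x \<sqinter> w} \<times> {b. b \<sqinter> x = \<bottom> \<and> b \<le> w}.
      mobius \<bottom> (fst p) * mobius \<bottom> (snd p))"
    by (rule sum.group) auto
  also have "\<dots> = (\<Sum>v | v \<le> x \<sqinter> w. mobius \<bottom> v) * (\<Sum>b | b \<sqinter> x = \<bottom> \<and> b \<le> w. mobius \<bottom> b)"
    by (simp only: sum_product sum.cartesian_product case_prod_unfold)
  also have "\<dots> = (\<Sum>y | y \<le> w. mobius \<bottom> y)"
  proof (cases "x \<sqinter> w = \<bottom>")
    case True
    then have "b \<sqinter> x = \<bottom>" if "b \<le> w" for b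
      using that by (metis bot_unique inf.commute inf_mono order_refl)
    then have "{b. b \<sqinter> x = \<bottom> \<and> b \<le> w} = {b. b \<le> w}" by auto
    with True show ?thesis by (simp add: sum_mobius_atMost)
  next
    case False
    \<comment> \<open>Both sides vanish here: the left one through its factor over \<open>v\<close>,
      the right one because \<open>w \<noteq> \<bottom>\<close>.\<close>
    then have "w \<noteq> \<bottom>" by auto
    with False show ?thesis by (simp add: sum_mobius_atMost del: le_inf_iff inf.bounded_iff)
  qed
  finally show "(\<Sum>y | y \<le> w. mobius \<bottom> y) = (\<Sum>y | y \<le> w. ?f y)" by simp
qed

lemma single_sum:
  "Poly_Mapping.single k (\<Sum>i\<in>A. f i) = (\<Sum>i\<in>A. Poly_Mapping.single k (f i))"
  by (induction A rule: infinite_finite_induct) (simp_all add: single_add)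

text \<open>After expanding each \<open>mobius \<bottom> y\<close>, every pair \<open>(v, b)\<close>
  occurs for exactly one \<open>y\<close>, its join, so the sum over \<open>y\<close>
  disappears.\<close>

lemma char_poly_eq_sum_join:
  fixes \<rho> :: "'a::{finite, bounded_lattice} \<Rightarrow> 'a \<Rightarrow> real"
  shows "char_poly \<rho> \<bottom> \<top> = (\<Sum>v\<in>{..x}. \<Sum>b | b \<sqinter> x = \<bottom>.
    Poly_Mapping.single (\<rho> (v \<squnion> b) \<top>) (mobius \<bottom> v * mobius \<bottom> b))"
proof -
  let ?P = "{..x} \<times> {b. b \<sqinter> x = \<bottom>}"
  have "char_poly \<rho> \<bottom> \<top> = (\<Sum>y\<in>UNIV. \<Sum>p | p \<in> ?P \<and> fst p \<squnion> snd p = y.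
      Poly_Mapping.single (\<rho> (fst p \<squnion> snd p) \<top>) (mobius \<bottom> (fst p) * mobius \<bottom> (snd p)))"
    unfolding char_poly_def
  proof (intro sum.cong)
    fix y :: 'a
    show "Poly_Mapping.single (\<rho> y \<top>) (mobius \<bottom> y) =
      (\<Sum>p | p \<in> ?P \<and> fst p \<squnion> snd p = y.
        Poly_Mapping.single (\<rho> (fst p \<squnion> snd p) \<top>) (mobius \<bottom> (fst p) * mobius \<bottom> (snd p)))"
      by (subst mobius_eq_sum_join[of y x], subst single_sum)
        (intro sum.cong, auto)
  qed auto
  also have "\<dots> = (\<Sum>p\<in>?P.
      Poly_Mapping.single (\<rho> (fst p \<squnion> snd p) \<top>) (mobius \<bottom> (fst p) * mobius \<bottom> (snd p)))"
    by (rule sum.group) auto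
  finally show ?thesis
    by (simp only: sum.cartesian_product case_prod_unfold)
qed

theorem theorem2p6:
  fixes \<rho> :: "'a::{finite, bounded_lattice} \<Rightarrow> 'a \<Rightarrow> real" and x :: 'a
  assumes "generalized_rank \<rho>"
    and "left_modular x"
    and "\<And>b. b \<in> mobius_support \<bottom> \<top> \<Longrightarrow> b \<sqinter> x = \<bottom> \<Longrightarrow>
           rank_preserving_on \<rho> \<rho> (\<lambda>v. v \<squnion> b) (mobius_support \<bottom> x \<union> {x})"
  shows "char_poly \<rho> \<bottom> \<top> =
         char_poly \<rho> \<bottom> x *
         (\<Sum>b | b \<in> mobius_support \<bottom> \<top> \<and> b \<sqinter> x = \<bottom>.
            Poly_Mapping.single (\<rho> \<bottom> \<top> - \<rho> \<bottom> x - \<rho> \<bottom> b) (mobius \<bottom> b))"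
proof -
  have rank: "\<rho> a c = \<rho> a b + \<rho> b c" if "a \<le> b" "b \<le> c" for a b c
    using assms(1) that unfolding generalized_rank_def by blast
  \<comment> \<open>The ranks from \<open>v\<close> and from \<open>\<bottom>\<close> up to
    \<open>x\<close> are both carried over by joining with \<open>b\<close>; additivity along
    \<open>\<bottom> \<le> b \<le> x \<squnion> b \<le> \<top>\<close> then eliminates
    \<open>\<rho> (x \<squnion> b) \<top>\<close>.\<close>
  have rank_join: "\<rho> (v \<squnion> b) \<top> = \<rho> v x + (\<rho> \<bottom> \<top> - \<rho> \<bottom> x - \<rho> \<bottom> b)"
    if v: "v \<le> x" "mobius \<bottom> v \<noteq> 0" and b: "b \<sqinter> x = \<bottom>" "mobius \<bottom> b \<noteq> 0" for v b
  proof -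
    have pres: "rank_preserving_on \<rho> \<rho> (\<lambda>v. v \<squnion> b) (mobius_support \<bottom> x \<union> {x})"
      using b by (intro assms(3)) (auto simp: mobius_support_def)
    have join: "\<rho> u x = \<rho> (u \<squnion> b) (x \<squnion> b)" if "u \<le> x" "mobius \<bottom> u \<noteq> 0" for u
      using pres that unfolding rank_preserving_on_def mobius_support_def by simp
    have "\<rho> v x = \<rho> (v \<squnion> b) (x \<squnion> b)" using v by (rule join)
    \<comment> \<open>\<open>\<bottom>\<close> lies in the support since
      \<open>mobius \<bottom> \<bottom> = 1\<close>, and its image is \<open>b\<close>.\<close>
    moreover have "\<rho> \<bottom> x = \<rho> b (x \<squnion> b)" using join[of \<bottom>] by simp
    moreover have "\<rho> (v \<squnion> b) \<top> = \<rho> (v \<squnion> b) (x \<squnion> b) + \<rho> (x \<squnion> b) \<top>"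
      using v by (intro rank) (auto intro: le_supI1)
    moreover have "\<rho> \<bottom> \<top> = \<rho> \<bottom> b + \<rho> b \<top>" by (intro rank) auto
    moreover have "\<rho> b \<top> = \<rho> b (x \<squnion> b) + \<rho> (x \<squnion> b) \<top>" by (intro rank) auto
    ultimately show ?thesis by simp
  qed
  have "char_poly \<rho> \<bottom> \<top> = (\<Sum>v\<in>{..x}. \<Sum>b | b \<sqinter> x = \<bottom>.
      Poly_Mapping.single (\<rho> (v \<squnion> b) \<top>) (mobius \<bottom> v * mobius \<bottom> b))"
    by (rule char_poly_eq_sum_join)
  also have "\<dots> = (\<Sum>v\<in>{..x}. \<Sum>b | b \<sqinter> x = \<bottom>.
      Poly_Mapping.single (\<rho> v x) (mobius \<bottom> v) *
      Poly_Mapping.single (\<rho> \<bottom> \<top> - \<rho> \<bottom> x - \<rho> \<bottom> b) (mobius \<bottom> b))"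
  proof (intro sum.cong refl)
    fix v b assume "v \<in> {..x}" "b \<in> {b. b \<sqinter> x = \<bottom>}"
    then show "Poly_Mapping.single (\<rho> (v \<squnion> b) \<top>) (mobius \<bottom> v * mobius \<bottom> b) =
      Poly_Mapping.single (\<rho> v x) (mobius \<bottom> v) *
      Poly_Mapping.single (\<rho> \<bottom> \<top> - \<rho> \<bottom> x - \<rho> \<bottom> b) (mobius \<bottom> b)"
      \<comment> \<open>The exponents need to match only when both Moebius values are nonzero;
        otherwise both sides are 0.\<close>
      using rank_join[of v b]
      by (cases "mobius \<bottom> v = 0 \<or> mobius \<bottom> b = 0") (auto simp: mult_single)
  qed
  also have "\<dots> = char_poly \<rho> \<bottom> x *
      (\<Sum>b | b \<sqinter> x = \<bottom>. Poly_Mapping.single (\<rho> \<bottom> \<top> - \<rho> \<bottom> x - \<rho> \<bottom> b) (mobius \<bottom> b))"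
  proof -
    have "{\<bottom>..x} = {..x}" by auto
    then show ?thesis by (simp only: char_poly_def sum_product)
  qed
  also have "(\<Sum>b | b \<sqinter> x = \<bottom>. Poly_Mapping.single (\<rho> \<bottom> \<top> - \<rho> \<bottom> x - \<rho> \<bottom> b) (mobius \<bottom> b)) =
      (\<Sum>b | b \<in> mobius_support \<bottom> \<top> \<and> b \<sqinter> x = \<bottom>.
        Poly_Mapping.single (\<rho> \<bottom> \<top> - \<rho> \<bottom> x - \<rho> \<bottom> b) (mobius \<bottom> b))"
    by (intro sum.mono_neutral_right) (auto simp: mobius_support_def)
  finally show ?thesis .
qed

end
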